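(* Consider the moving mesh $P^0$ discontinuous Galerkin scheme with explicit Euler time stepping, Gaussian quadrature on the edges and Lax–Friedrichs numerical flux (all defined in the context) for the linear scalar conservation law $U_t+\nabla\cdot(\bm a(\bm x,t)U)=0$ on a cubical domain $\Omega\subset\mathbb{R}^d$ ($d\ge 1$), with periodic boundary conditions and with $\bm a$ periodic in each coordinate direction: $$|K^{n+1}|\,\bar U_{h,K}^{n+1}=|K^n|\,\bar U_{h,K}^n-\Delta t_n\sum_{e\in\partial K^n}|e|\sum_{\bm x_G^e}w_G^e\,\hat{\mathbf H}_{K,e}^n(\bm x_G^e)\qquad\text{for every element } K^n\in\mathcal T_h^n .$$ Let $\alpha_{CFL}^n$ be a function on the quadrature points of the edges of $\mathcal T_h^n$ satisfying $\alpha_{CFL}^n(\bm x_G^e)\ge\alpha_{LF}^n(\bm x_G^e)$ at every quadrature point $\bm x_G^e$ of every edge $e$. If the time step satisfies the CFL condition $$\Delta t_n\le\frac{1}{\max\limits_{K^n\in\mathcal T_h^n}\Big(\frac{1}{|K^n|}\sum\limits_{e\in\partial K^n}|e|\sum\limits_{\bm x_G^e}w_G^e\,\alpha_{CFL}^n(\bm x_G^e)\Big)},$$ then the scheme is $L^1$-stable, that is, $$\sum_{K^{n+1}\in\mathcal T_h^{n+1}}|K^{n+1}|\,|\bar U_{h,K}^{n+1}|\le\sum_{K^n\in\mathcal T_h^n}|K^n|\,|\bar U_{h,K}^n| .$$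
   Context: **Domain and meshes.** $\Omega\subset\mathbb{R}^d$ is a cube and periodic boundary conditions are used: opposite faces of $\Omega$ are identified, and the meshes and mesh velocity are compatible with this identification. $\mathcal T_h^n$ and $\mathcal T_h^{n+1}$ are (nondegenerate) simplicial meshes of $\Omega$ at times $t_n$ and $t_{n+1}=t_n+\Delta t_n$ ($\Delta t_n>0$), with the same number of elements and vertices and the same connectivity. The vertices are $\bm x_i^n$ and $\bm x_i^{n+1}$, $i=1,\dots,N_v$. $K^n$ and $K^{n+1}$ denote corresponding elements of the two meshes. An "edge" $e\in\partial K$ means a $(d-1)$-dimensional face of the simplex $K$. $|K|$ and $|e|$ denote the $d$- and $(d-1)$-dimensional measures ($|e|=1$ for $d=1$). Modulo the periodic identification, each edge $e$ of $K$ is shared with exactly one neighbouring element, denoted $K'$. $\bm n=\bm n_{K,e}$ is the unit normal to $e$ pointing out of $K$, so that $\bm n_{K',e}=-\bm n_{K,e}$. **Mesh velocity.** At time $t_n$, $\dot{\bm X}$ is the continuous piecewise linear function on $\mathcal T_h^n$ with nodal values $\dot{\bm x}_i=(\bm x_i^{n+1}-\bm x_i^n)/\Delta t_n$. **Quadrature.** On each edge $e$ a quadrature rule with points $\bm x_G^e\in e$ and weights $w_G^e\ge 0$, $\sum w_G^e=1$, is used (the same rule seen from both elements sharing $e$). **Discrete solution.** For $P^0$ elements the numerical solution $U_h^n$ at time $t_n$ is constant on each $K^n$, with value $\bar U_{h,K}^n\in\mathbb{R}$. On an edge $e$ of $K^n$, $U_{h,K}^{n,int}=\bar U_{h,K}^n$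 and $U_{h,K}^{n,ext}=\bar U_{h,K'}^n$. **Numerical flux.** For $\bm x\in e\subset\partial K^n$ set $$\lambda^n(\bm x)=\lambda^n_{K,e}(\bm x)=(\bm a(\bm x,t_n)-\dot{\bm X}(\bm x,t_n))\cdot\bm n_{K,e},\qquad \alpha^n(\bm x)=|\lambda^n(\bm x)| .$$ The (global or local) Lax–Friedrichs flux is $$\hat{\mathbf H}_{K,e}^n(\bm x)=\tfrac12\Big(\lambda^n(\bm x)\,\big(U_{h,K}^{n,int}+U_{h,K}^{n,ext}\big)-\alpha_{LF}^n(\bm x)\,\big(U_{h,K}^{n,ext}-U_{h,K}^{n,int}\big)\Big),$$ where $\alpha_{LF}^n$ is one of the following choices, each of which takes the same value seen from either element sharing $e$: - pointwise: $\alpha_{LF}^n(\bm x_G^e)=\alpha^n(\bm x_G^e)$; - edge maximum: $\alpha_{LF}^n(\bm x_G^e)=\max_{\bm y_G^e}\alpha^n(\bm y_G^e)$, the maximum over the quadrature points $\bm y_G^e$ of $e$; - global maximum: $\alpha_{LF}^n$ is the maximum of $\alpha^n$ over all quadrature points of all edges of the mesh. **Convention.** If the denominator in the CFL condition is $0$, the condition is vacuous. *)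

theory Defs
  imports "HOL-Analysis.Analysis"
begin

section \<open>Periodic simplicial meshes of a cube\<close>

definition cube :: "real^'d \<Rightarrow> real \<Rightarrow> (real^'d) set" where
  "cube c L = cbox c (\<chi> i. c $ i + L)"

text \<open>
  Translations by vectors of this lattice realise the identification of opposite
  faces of a cube with side length \<open>L\<close>.
\<close>

definition periods :: "real \<Rightarrow> (real^'d) set" where
  "periods L = {v. \<forall>i. \<exists>k::int. v $ i = of_int k * L}"

text \<open>
  A mesh is given by its connectivity \<open>T\<close>, in which an element is the set of the indices of
  its \<open>d + 1\<close> vertices, together with the vertex positions \<open>x\<close>.  Two meshes with the same
  connectivity share \<open>T\<close>, and \<open>s \<in> T\<close> names the corresponding elements \<open>elem x s\<close> and
  \<open>elem x' s\<close>.  Both copies of a vertex (edge) lying on opposite faces of the cube are listed.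
\<close>

definition elem :: "(nat \<Rightarrow> real^'d) \<Rightarrow> nat set \<Rightarrow> (real^'d) set" where
  "elem x s = convex hull (x ` s)"

definition simplicial_mesh ::
  "(real^'d) set \<Rightarrow> nat \<Rightarrow> nat set set \<Rightarrow> (nat \<Rightarrow> real^'d) \<Rightarrow> bool" where
  "simplicial_mesh \<Omega> Nv T x \<longleftrightarrow>
     inj_on x {1..Nv} \<and> \<Union>T = {1..Nv} \<and>
     (\<forall>s\<in>T. card s = CARD('d) + 1 \<and> \<not> affine_dependent (x ` s)) \<and>
     triangulation (elem x ` T) \<and> \<Union>(elem x ` T) = \<Omega>"

text \<open>The ``edges'' of a \<open>d\<close>-simplex are its \<open>(d - 1)\<close>-dimensional faces.\<close>

definition edges :: "(real^'d) set \<Rightarrow> (real^'d) set set" where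
  "edges K = {e. e facet_of K}"

definition sides :: "nat set set \<Rightarrow> (nat \<Rightarrow> real^'d) \<Rightarrow> (nat set \<times> (real^'d) set) set" where
  "sides T x = {(s, e). s \<in> T \<and> e \<in> edges (elem x s)}"

text \<open>
  Side \<open>(s', e')\<close> lies across side \<open>(s, e)\<close> if \<open>e\<close> and \<open>e'\<close> coincide modulo the periodic
  identification (for an edge in the interior of the cube this means \<open>e' = e\<close>).  The two
  elements may be equal, namely if \<open>d = 1\<close> and the mesh consists of a single element.
\<close>

definition across ::
  "real \<Rightarrow> nat set set \<Rightarrow> (nat \<Rightarrow> real^'d) \<Rightarrow>
     nat set \<times> (real^'d) set \<Rightarrow> nat set \<times> (real^'d) set \<Rightarrow> bool" where
  "across L T x p p' \<longleftrightarrow>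
     p' \<in> sides T x \<and> p' \<noteq> p \<and> (\<exists>v\<in>periods L. snd p' = (+) v ` snd p)"

text \<open>
  Compatibility with the identification of opposite faces: modulo periodicity, each edge of an
  element is shared with exactly one neighbour.
\<close>

definition periodic_mesh ::
  "real^'d \<Rightarrow> real \<Rightarrow> nat \<Rightarrow> nat set set \<Rightarrow> (nat \<Rightarrow> real^'d) \<Rightarrow> bool" where
  "periodic_mesh c L Nv T x \<longleftrightarrow>
     simplicial_mesh (cube c L) Nv T x \<and>
     (\<forall>p\<in>sides T x. \<exists>!p'. across L T x p p')"

definition neighbour ::
  "real \<Rightarrow> nat set set \<Rightarrow> (nat \<Rightarrow> real^'d) \<Rightarrow> nat set \<Rightarrow> (real^'d) set \<Rightarrow> nat set" where
  "neighbour L T x s e = fst (THE p'. across L T x (s, e) p')"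

definition outward_normal :: "(real^'d) set \<Rightarrow> (real^'d) set \<Rightarrow> real^'d" where
  "outward_normal K e =
     (THE n. norm n = 1 \<and> (\<forall>y\<in>e. \<forall>z\<in>e. n \<bullet> (z - y) = 0) \<and>
             (\<forall>y\<in>e. \<forall>z\<in>K. n \<bullet> (z - y) \<le> 0))"

text \<open>
  The \<open>(d - 1)\<close>-dimensional measure of an edge is the \<open>d\<close>-dimensional Lebesgue measure of the
  right prism of height one over it.  For \<open>d = 1\<close> the prism over a point is a unit interval,
  which gives the convention that a point has measure one.
\<close>

definition edge_measure :: "(real^'d) set \<Rightarrow> (real^'d) set \<Rightarrow> real" where
  "edge_measure K e =
     measure lebesgue {y + \<tau> *\<^sub>R outward_normal K e | y \<tau>. y \<in> e \<and> \<tau> \<in> {0..1}}"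


section \<open>Mesh velocity and quadrature\<close>

definition nodal_velocity ::
  "(nat \<Rightarrow> real^'d) \<Rightarrow> (nat \<Rightarrow> real^'d) \<Rightarrow> real \<Rightarrow> nat \<Rightarrow> real^'d" where
  "nodal_velocity x x' dt i = (1 / dt) *\<^sub>R (x' i - x i)"

definition periodic_velocity ::
  "real \<Rightarrow> nat \<Rightarrow> (nat \<Rightarrow> real^'d) \<Rightarrow> (nat \<Rightarrow> real^'d) \<Rightarrow> real \<Rightarrow> bool" where
  "periodic_velocity L Nv x x' dt \<longleftrightarrow>
     (\<forall>i\<in>{1..Nv}. \<forall>j\<in>{1..Nv}. x j - x i \<in> periods L \<longrightarrow>
        nodal_velocity x x' dt j = nodal_velocity x x' dt i)"

text \<open>
  \<open>X\<close> is the mesh velocity at the old time level: the continuous piecewise linear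
  interpolant of the nodal velocities.  These conditions determine \<open>X\<close> on the whole cube.
\<close>

definition mesh_velocity ::
  "nat \<Rightarrow> nat set set \<Rightarrow> (nat \<Rightarrow> real^'d) \<Rightarrow> (nat \<Rightarrow> real^'d) \<Rightarrow> real \<Rightarrow>
     (real^'d \<Rightarrow> real^'d) \<Rightarrow> bool" where
  "mesh_velocity Nv T x x' dt X \<longleftrightarrow>
     continuous_on (\<Union>s\<in>T. elem x s) X \<and>
     (\<forall>s\<in>T. \<exists>f b. linear f \<and> (\<forall>y\<in>elem x s. X y = f y + b)) \<and>
     (\<forall>i\<in>{1..Nv}. X (x i) = nodal_velocity x x' dt i)"

text \<open>
  \<open>Q e\<close> is the set of quadrature points of \<open>e\<close> and \<open>w e y\<close> the weight of \<open>y \<in> Q e\<close>.  Periodic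
  images of the same edge carry the same rule.
\<close>

definition edge_quadrature ::
  "real \<Rightarrow> (real^'d) set set \<Rightarrow> ((real^'d) set \<Rightarrow> (real^'d) set) \<Rightarrow>
     ((real^'d) set \<Rightarrow> real^'d \<Rightarrow> real) \<Rightarrow> bool" where
  "edge_quadrature L E Q w \<longleftrightarrow>
     (\<forall>e\<in>E. finite (Q e) \<and> Q e \<subseteq> e \<and> (\<forall>y\<in>Q e. w e y \<ge> 0) \<and> (\<Sum>y\<in>Q e. w e y) = 1) \<and>
     (\<forall>e\<in>E. \<forall>v\<in>periods L. (+) v ` e \<in> E \<longrightarrow>
        Q ((+) v ` e) = (+) v ` Q e \<and> (\<forall>y\<in>Q e. w ((+) v ` e) (v + y) = w e y))"


section \<open>Lax--Friedrichs flux\<close>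

definition lam ::
  "(real^'d \<Rightarrow> real \<Rightarrow> real^'d) \<Rightarrow> (real^'d \<Rightarrow> real^'d) \<Rightarrow> real \<Rightarrow>
     (real^'d) set \<Rightarrow> (real^'d) set \<Rightarrow> real^'d \<Rightarrow> real" where
  "lam a X t K e y = (a y t - X y) \<bullet> outward_normal K e"

definition alpha ::
  "(real^'d \<Rightarrow> real \<Rightarrow> real^'d) \<Rightarrow> (real^'d \<Rightarrow> real^'d) \<Rightarrow> real \<Rightarrow>
     (real^'d) set \<Rightarrow> (real^'d) set \<Rightarrow> real^'d \<Rightarrow> real" where
  "alpha a X t K e y = \<bar>lam a X t K e y\<bar>"

datatype lf_choice = Pointwise | Edge_Maximum | Global_Maximum

fun alpha_LF ::
  "lf_choice \<Rightarrow> (real^'d \<Rightarrow> real \<Rightarrow> real^'d) \<Rightarrow> (real^'d \<Rightarrow> real^'d) \<Rightarrow> real \<Rightarrow>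
     ((real^'d) set \<Rightarrow> (real^'d) set) \<Rightarrow> nat set set \<Rightarrow> (nat \<Rightarrow> real^'d) \<Rightarrow>
     nat set \<Rightarrow> (real^'d) set \<Rightarrow> real^'d \<Rightarrow> real" where
  "alpha_LF Pointwise a X t Q T x s e y = alpha a X t (elem x s) e y"
| "alpha_LF Edge_Maximum a X t Q T x s e y = Max (alpha a X t (elem x s) e ` Q e)"
| "alpha_LF Global_Maximum a X t Q T x s e y =
     Max {alpha a X t (elem x s') e' y' | s' e' y'.
            s' \<in> T \<and> e' \<in> edges (elem x s') \<and> y' \<in> Q e'}"

text \<open>\<open>U s\<close> is the constant value of the discrete solution on the element \<open>s\<close>.\<close>

definition LF_flux ::
  "lf_choice \<Rightarrow> (real^'d \<Rightarrow> real \<Rightarrow> real^'d) \<Rightarrow> (real^'d \<Rightarrow> real^'d) \<Rightarrow> real \<Rightarrow>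
     ((real^'d) set \<Rightarrow> (real^'d) set) \<Rightarrow> real \<Rightarrow> nat set set \<Rightarrow> (nat \<Rightarrow> real^'d) \<Rightarrow>
     (nat set \<Rightarrow> real) \<Rightarrow> nat set \<Rightarrow> (real^'d) set \<Rightarrow> real^'d \<Rightarrow> real" where
  "LF_flux ch a X t Q L T x U s e y =
     (let Uint = U s; Uext = U (neighbour L T x s e) in
      1 / 2 * (lam a X t (elem x s) e y * (Uint + Uext)
               - alpha_LF ch a X t Q T x s e y * (Uext - Uint)))"

definition cfl_denominator ::
  "nat set set \<Rightarrow> (nat \<Rightarrow> real^'d) \<Rightarrow> ((real^'d) set \<Rightarrow> (real^'d) set) \<Rightarrow>
     ((real^'d) set \<Rightarrow> real^'d \<Rightarrow> real) \<Rightarrow> ((real^'d) set \<Rightarrow> real^'d \<Rightarrow> real) \<Rightarrow> real" where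
  "cfl_denominator T x Q w aCFL =
     Max ((\<lambda>s. 1 / measure lebesgue (elem x s) *
               (\<Sum>e\<in>edges (elem x s). edge_measure (elem x s) e *
                  (\<Sum>y\<in>Q e. w e y * aCFL e y))) ` T)"

end

theory Submission
  imports Defs
begin

text \<open>
  Write \<open>\<mu>\<close> for the normal speed \<^const>\<open>lam\<close> and \<open>\<alpha>\<close> for \<^const>\<open>alpha_LF\<close>.  The Lax--Friedrichs
  flux splits as
  \<open>(\<alpha> + \<mu>) / 2 * U_int - (\<alpha> - \<mu>) / 2 * U_ext\<close>: what leaves the element minus what enters it.
  Both coefficients are nonnegative since \<open>\<alpha> \<ge> \<bar>\<mu>\<bar>\<close>, and \<open>(\<alpha> + \<mu>) / 2 \<le> \<alpha>\<close>, so by the CFL condition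
  an element loses in one step at most what it holds.  The new content of an element is therefore
  a combination of the old values with nonnegative coefficients, and absolute values can be taken
  termwise.

  Summing over the mesh, it remains to see that inflow and outflow balance.  Seen from the
  neighbour, \<open>\<mu>\<close> changes its sign while \<open>\<alpha>\<close>, the edge measure and the quadrature rule stay the
  same; hence the inflow coefficient of a side is the outflow coefficient of the side opposite to
  it, and going to the opposite side is an involution of the set of all sides.  This bookkeeping
  is \<open>paired_transport_L1_stable\<close>.

  The change of sign is a fact of geometry.  The two outward normals of an edge
  are opposite (\<open>outward_normal_across\<close>): inside the cube because two elements of a triangulation
  that share a facet lie on different sides of it, and at the boundary because an edge and its
  periodic image lie on opposite faces of the cube.  Moreover both velocities take the same value
  at corresponding points (\<open>translate_period\<close>, \<open>mesh_velocity_across\<close>).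
\<close>

section \<open>Outward normals of facets\<close>

text \<open>The property by which \<^const>\<open>outward_normal\<close> selects its value.\<close>

definition is_outward_normal :: "(real^'d) set \<Rightarrow> (real^'d) set \<Rightarrow> real^'d \<Rightarrow> bool" where
  "is_outward_normal K e n \<longleftrightarrow>
     norm n = 1 \<and> (\<forall>y\<in>e. \<forall>z\<in>e. n \<bullet> (z - y) = 0) \<and> (\<forall>y\<in>e. \<forall>z\<in>K. n \<bullet> (z - y) \<le> 0)"

text \<open>
  The facet spans a whole hyperplane, because an affine set that is contained in a hyperplane
  and has the same dimension equals it.
\<close>

lemma affine_hull_facet:
  fixes e :: "(real^'d) set"
  assumes dim: "aff_dim e = int CARD('d) - 1"
    and n: "n \<noteq> 0" "\<forall>y\<in>e. \<forall>z\<in>e. n \<bullet> (z - y) = 0" and y: "y \<in> e"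
  shows "affine hull e = {z. n \<bullet> (z - y) = 0}"
proof -
  have eq: "{z. n \<bullet> (z - y) = 0} = {z. n \<bullet> z = n \<bullet> y}"
    by (simp add: inner_diff_right)
  have "affine hull e = {z. n \<bullet> z = n \<bullet> y}"
  proof (rule affine_dim_equal)
    show "affine hull e \<subseteq> {z. n \<bullet> z = n \<bullet> y}"
    proof (rule hull_minimal)
      have "e \<subseteq> {z. n \<bullet> (z - y) = 0}" using n(2) y by blast
      then show "e \<subseteq> {z. n \<bullet> z = n \<bullet> y}" unfolding eq .
    qed (rule affine_hyperplane)
    show "aff_dim (affine hull e) = aff_dim {z. n \<bullet> z = n \<bullet> y}"
      using n dim by (simp add: aff_dim_hyperplane)
  qed (use y in \<open>auto simp: affine_hyperplane\<close>)
  with eq show ?thesis by simp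
qed

text \<open>
  Existence: faces of polytopes are exposed, so a supporting hyperplane cuts out the facet.
  Uniqueness: both candidates are unit normals of the one hyperplane spanned by the facet,
  hence equal up to sign, and a point of the polytope off that hyperplane decides the sign.
\<close>

lemma ex1_is_outward_normal:
  fixes K :: "(real^'d) set"
  assumes K: "polytope K" "aff_dim K = int CARD('d)" and e: "e facet_of K"
  shows "\<exists>!n. is_outward_normal K e n"
proof -
  have face: "e face_of K" and ne: "e \<noteq> {}" and dim: "aff_dim e = int CARD('d) - 1"
    using e K by (auto simp: facet_of_def)
  have "e \<noteq> K" using dim K by auto
  have "e exposed_face_of K"
    using exposed_face_of_polyhedron polytope_imp_polyhedron K face by blast
  then obtain m b where m: "m \<noteq> 0" "K \<subseteq> {x. m \<bullet> x \<le> b}" "e = K \<inter> {x. m \<bullet> x = b}"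
    using ne \<open>e \<noteq> K\<close> by (auto simp: exposed_face_of)
  define n where "n = (1 / norm m) *\<^sub>R m"
  have n: "is_outward_normal K e n"
    using m by (auto simp: is_outward_normal_def n_def inner_diff_right divide_simps)
  obtain y where y: "y \<in> e" using ne by auto
  obtain z where z: "z \<in> K" "z \<notin> e"
    using \<open>e \<noteq> K\<close> face face_of_imp_subset by blast
  have nz: "n \<bullet> (z - y) < 0"
    using z m y by (auto simp: n_def inner_diff_right divide_simps order_le_less)
  have "p = n" if p: "is_outward_normal K e p" for p
  proof -
    have n1: "n \<bullet> n = 1" and p1: "p \<bullet> p = 1"
      using n p by (auto simp: is_outward_normal_def norm_eq_1)
    \<comment> \<open>The component of \<open>p\<close> tangential to the hyperplane orthogonal to \<open>n\<close> must vanish.\<close>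
    define \<tau> where "\<tau> = p - (p \<bullet> n) *\<^sub>R n"
    have hull: "affine hull e = {z. q \<bullet> (z - y) = 0}" if "is_outward_normal K e q" for q
      using that by (intro affine_hull_facet dim y) (auto simp: is_outward_normal_def)
    have "y + \<tau> \<in> affine hull e"
      unfolding hull[OF n] by (simp add: \<tau>_def inner_diff_right inner_add_right inner_commute n1)
    then have "p \<bullet> \<tau> = 0"
      unfolding hull[OF p] by simp
    then have "\<tau> \<bullet> \<tau> = 0"
      by (simp add: \<tau>_def inner_diff_left inner_diff_right inner_commute n1)
    then have pn: "p = (p \<bullet> n) *\<^sub>R n" by (simp add: \<tau>_def)
    have "p \<bullet> (z - y) \<le> 0"
      using p y z by (auto simp: is_outward_normal_def)
    then have "(p \<bullet> n) * (n \<bullet> (z - y)) \<le> 0"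
      by (metis pn inner_scaleR_left)
    then have "p \<bullet> n \<ge> 0"
      using nz by (simp add: mult_le_0_iff)
    moreover have "(p \<bullet> n)\<^sup>2 = 1"
      using p1 pn n1 by (metis inner_scaleR_right power2_eq_square)
    ultimately have "p \<bullet> n = 1"
      by (simp add: power2_eq_1_iff)
    then show ?thesis using pn by simp
  qed
  with n show ?thesis by blast
qed

lemma outward_normal_The: "outward_normal K e = (THE n. is_outward_normal K e n)"
  unfolding outward_normal_def is_outward_normal_def ..

lemma is_outward_normal_outward_normal:
  fixes K :: "(real^'d) set"
  assumes "polytope K" "aff_dim K = int CARD('d)" "e facet_of K"
  shows "is_outward_normal K e (outward_normal K e)"
  unfolding outward_normal_The by (rule theI'[OF ex1_is_outward_normal[OF assms]])

lemma outward_normal_eqI: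
  fixes K :: "(real^'d) set"
  assumes "polytope K" "aff_dim K = int CARD('d)" "e facet_of K" "is_outward_normal K e n"
  shows "outward_normal K e = n"
  unfolding outward_normal_The by (rule the1_equality[OF ex1_is_outward_normal[OF assms(1-3)] assms(4)])

text \<open>
  Near a relative interior point \<open>y\<close> of the facet, \<open>K\<close> fills the half-space behind the facet:
  a direction pointing strictly inwards is a positive multiple of \<open>z - y\<close> for a fixed
  \<open>z \<in> K\<close> off the facet plus a tangential vector, and a short tangential step stays in the facet.
\<close>

lemma convex_step_inwards:
  fixes K :: "(real^'d) set"
  assumes K: "convex K" and eK: "e \<subseteq> K" and dim: "aff_dim e = int CARD('d) - 1"
    and n: "n \<noteq> 0" "\<forall>y\<in>e. \<forall>z\<in>e. n \<bullet> (z - y) = 0"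
    and y: "y \<in> rel_interior e" and z: "z \<in> K" "n \<bullet> (z - y) < 0"
    and u: "n \<bullet> u < 0"
  obtains \<epsilon> where "0 < \<epsilon>" "\<epsilon> < 1" "y + \<epsilon> *\<^sub>R u \<in> K"
proof -
  obtain r where r: "r > 0" "cball y r \<inter> affine hull e \<subseteq> e" and ye: "y \<in> e"
    using y by (auto simp: mem_rel_interior_cball)
  define k where "k = (n \<bullet> u) / (n \<bullet> (z - y))"
  define \<tau> where "\<tau> = u - k *\<^sub>R (z - y)"
  have k: "k > 0" using u z by (simp add: k_def divide_neg_neg)
  have n\<tau>: "n \<bullet> \<tau> = 0" using z by (simp add: \<tau>_def k_def inner_diff_right)
  \<comment> \<open>The bounds needed below are \<open>\<epsilon> k \<le> 1 / 2\<close> and \<open>2 \<epsilon> |\<tau>| \<le> r\<close>.\<close>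
  define \<epsilon> where "\<epsilon> = min (1 / 2) (min (1 / (2 * k)) (r / (2 * (norm \<tau> + 1))))"
  have \<epsilon>: "0 < \<epsilon>" "\<epsilon> < 1" "\<epsilon> * k \<le> 1 / 2" "2 * \<epsilon> * norm \<tau> \<le> r"
  proof -
    show e0: "0 < \<epsilon>"
      using k r by (auto simp: \<epsilon>_def intro!: divide_pos_pos add_nonneg_pos)
    show "\<epsilon> < 1" by (simp add: \<epsilon>_def)
    have "\<epsilon> \<le> 1 / (2 * k)" by (simp add: \<epsilon>_def)
    then show "\<epsilon> * k \<le> 1 / 2" using k by (simp add: field_simps)
    have "\<epsilon> \<le> r / (2 * (norm \<tau> + 1))" by (simp add: \<epsilon>_def)
    moreover have "norm \<tau> + 1 > 0" by (simp add: add_nonneg_pos)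
    ultimately have "2 * \<epsilon> * (norm \<tau> + 1) \<le> r" by (simp add: field_simps)
    then show "2 * \<epsilon> * norm \<tau> \<le> r" using e0 by (simp add: algebra_simps)
  qed
  define q where "q = y + (\<epsilon> / (1 - \<epsilon> * k)) *\<^sub>R \<tau>"
  have pos: "1 - \<epsilon> * k > 0" using \<epsilon> by linarith
  have "\<epsilon> / (1 - \<epsilon> * k) \<le> 2 * \<epsilon>"
    using \<epsilon> pos by (simp add: divide_simps)
  then have "(\<epsilon> / (1 - \<epsilon> * k)) * norm \<tau> \<le> 2 * \<epsilon> * norm \<tau>"
    by (intro mult_right_mono) auto
  then have "q \<in> cball y r"
    using \<epsilon> pos by (simp add: q_def dist_norm)
  moreover have "q \<in> affine hull e"
    using n\<tau> by (simp add: affine_hull_facet[OF dim n ye] q_def)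
  ultimately have "q \<in> K" using r eK by auto
  then have "(1 - \<epsilon> * k) *\<^sub>R q + (\<epsilon> * k) *\<^sub>R z \<in> K"
    using K z pos \<epsilon> k by (intro convexD) auto
  also have "(1 - \<epsilon> * k) *\<^sub>R q + (\<epsilon> * k) *\<^sub>R z = y + \<epsilon> *\<^sub>R u"
  proof -
    have "(1 - \<epsilon> * k) *\<^sub>R q = (1 - \<epsilon> * k) *\<^sub>R y + \<epsilon> *\<^sub>R \<tau>"
      using pos by (simp add: q_def scaleR_add_right)
    then show ?thesis by (simp add: \<tau>_def algebra_simps)
  qed
  finally show ?thesis using that \<epsilon> by blast
qed

text \<open>
  Two bodies that meet exactly in a common facet lie on opposite sides of it: otherwise a short
  step from the facet towards a point of one of them would stay in the other.
\<close>

lemma outward_normal_common_facet: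
  fixes K K' :: "(real^'d) set"
  assumes K: "polytope K" "aff_dim K = int CARD('d)" and K': "polytope K'" "aff_dim K' = int CARD('d)"
    and e: "e facet_of K" "e facet_of K'" and int: "K \<inter> K' = e"
  shows "outward_normal K' e = - outward_normal K e"
proof (rule outward_normal_eqI[OF K' e(2)])
  define n where "n = outward_normal K e"
  have n: "is_outward_normal K e n"
    unfolding n_def by (rule is_outward_normal_outward_normal[OF K e(1)])
  have dim: "aff_dim e = int CARD('d) - 1" and ne: "e \<noteq> {}"
    using e K by (auto simp: facet_of_def)
  have eK: "e \<subseteq> K" using e facet_of_imp_subset by blast
  have "convex e" using e facet_of_imp_face_of face_of_imp_convex by blast
  then obtain y where y: "y \<in> rel_interior e" using ne rel_interior_eq_empty by blast
  then have ye: "y \<in> e" using rel_interior_subset by blast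
  have n0: "n \<noteq> 0" and nt: "\<forall>y\<in>e. \<forall>z\<in>e. n \<bullet> (z - y) = 0"
    using n by (auto simp: is_outward_normal_def)
  have "\<exists>z\<in>K. z \<notin> affine hull e"
  proof (rule ccontr)
    assume "\<not> ?thesis"
    then have "aff_dim K \<le> aff_dim (affine hull e)" by (intro aff_dim_subset) auto
    then show False using K dim by simp
  qed
  then obtain z where z: "z \<in> K" "n \<bullet> (z - y) \<noteq> 0"
    using affine_hull_facet[OF dim n0 nt ye] by auto
  have "n \<bullet> (z - y) \<le> 0"
    using n ye z(1) unfolding is_outward_normal_def by blast
  then have z': "n \<bullet> (z - y) < 0" using z(2) by linarith
  have side: "n \<bullet> (p - y) \<ge> 0" if p: "p \<in> K'" for p
  proof (rule ccontr)
    assume "\<not> n \<bullet> (p - y) \<ge> 0"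
    then have neg: "n \<bullet> (p - y) < 0" by simp
    obtain \<epsilon> where \<epsilon>: "0 < \<epsilon>" "\<epsilon> < 1" "y + \<epsilon> *\<^sub>R (p - y) \<in> K"
      using convex_step_inwards[OF polytope_imp_convex[OF K(1)] eK dim n0 nt y z(1) z' neg] by blast
    have "(1 - \<epsilon>) *\<^sub>R y + \<epsilon> *\<^sub>R p \<in> K'"
      using polytope_imp_convex[OF K'(1)] p ye e(2) facet_of_imp_subset \<epsilon>
      by (intro convexD) auto
    moreover have "(1 - \<epsilon>) *\<^sub>R y + \<epsilon> *\<^sub>R p = y + \<epsilon> *\<^sub>R (p - y)"
      by (simp add: algebra_simps)
    ultimately have "y + \<epsilon> *\<^sub>R (p - y) \<in> e" using \<epsilon> int by auto
    then have "n \<bullet> (y + \<epsilon> *\<^sub>R (p - y) - y) = 0" using nt ye by blast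
    then show False using \<epsilon> neg by simp
  qed
  have "n \<bullet> (p - q) \<ge> 0" if "p \<in> K'" "q \<in> e" for p q
    using side[OF that(1)] nt[rule_format, OF that(2) ye] by (simp add: inner_diff_right)
  then show "is_outward_normal K' e (- outward_normal K e)"
    using n nt by (simp add: is_outward_normal_def flip: n_def)
qed

text \<open>
  The right prisms over an edge and over its translate with the opposite normal are translates
  of each other.
\<close>

lemma edge_measure_translate:
  assumes "outward_normal K' ((+) v ` e) = - outward_normal K e"
  shows "edge_measure K' ((+) v ` e) = edge_measure K e"
proof -
  let ?n = "outward_normal K e"
  have "{y + \<tau> *\<^sub>R (- ?n) | y \<tau>. y \<in> (+) v ` e \<and> \<tau> \<in> {0..1}} =
        (+) (v - ?n) ` {y + \<tau> *\<^sub>R ?n | y \<tau>. y \<in> e \<and> \<tau> \<in> {0..1}}" (is "?A = (+) _ ` ?B")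
  proof (intro equalityI subsetI)
    fix p assume "p \<in> ?A"
    then obtain y \<tau> where "y \<in> e" "\<tau> \<in> {0..1}" "p = v + y + \<tau> *\<^sub>R (- ?n)" by auto
    then have "p = (v - ?n) + (y + (1 - \<tau>) *\<^sub>R ?n)" by (simp add: algebra_simps)
    moreover have "1 - \<tau> \<in> {0..1}" using \<open>\<tau> \<in> {0..1}\<close> by simp
    ultimately show "p \<in> (+) (v - ?n) ` ?B" using \<open>y \<in> e\<close> by blast
  next
    fix p assume "p \<in> (+) (v - ?n) ` ?B"
    then obtain y \<tau> where y: "y \<in> e" "\<tau> \<in> {0..1}" "p = (v - ?n) + (y + \<tau> *\<^sub>R ?n)" by auto
    then have "p = (v + y) + (1 - \<tau>) *\<^sub>R (- ?n)" by (simp add: algebra_simps)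
    moreover have "v + y \<in> (+) v ` e" "1 - \<tau> \<in> {0..1}" using y by auto
    ultimately show "p \<in> ?A" by blast
  qed
  then show ?thesis
    by (simp add: edge_measure_def assms measure_translation)
qed

section \<open>Elements and edges of a periodic simplicial mesh\<close>

lemma finite_mesh: "simplicial_mesh \<Omega> Nv T x \<Longrightarrow> finite T"
  unfolding simplicial_mesh_def by (metis finite_UnionD finite_atLeastAtMost)

lemma
  fixes x :: "nat \<Rightarrow> real^'d"
  assumes mesh: "simplicial_mesh \<Omega> Nv T x" and s: "s \<in> T"
  shows polytope_elem: "polytope (elem x s)"
    and aff_dim_elem: "aff_dim (elem x s) = int CARD('d)"
    and elem_subset: "elem x s \<subseteq> \<Omega>"
    and vertices_subset: "s \<subseteq> {1..Nv}"
proof -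
  show sub: "s \<subseteq> {1..Nv}" using assms by (auto simp: simplicial_mesh_def)
  have "finite s" using sub finite_subset by blast
  then show "polytope (elem x s)" by (auto simp: elem_def polytope_def)
  have "inj_on x s" using mesh sub by (auto simp: simplicial_mesh_def intro: inj_on_subset)
  then have "card (x ` s) = CARD('d) + 1"
    using assms by (auto simp: simplicial_mesh_def card_image)
  then show "aff_dim (elem x s) = int CARD('d)"
    using assms aff_dim_affine_independent[of "x ` s"]
    by (auto simp: simplicial_mesh_def elem_def aff_dim_convex_hull)
  show "elem x s \<subseteq> \<Omega>" using assms by (auto simp: simplicial_mesh_def)
qed

lemma extreme_points_elem:
  assumes "simplicial_mesh \<Omega> Nv T x" "s \<in> T"
  shows "{v. v extreme_point_of elem x s} = x ` s"
  using assms by (auto simp: simplicial_mesh_def elem_def extreme_point_of_convex_hull_affine_independent)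

lemma inj_on_elem:
  assumes mesh: "simplicial_mesh \<Omega> Nv T x"
  shows "inj_on (elem x) T"
proof (rule inj_onI)
  fix s s' assume s: "s \<in> T" "s' \<in> T" and "elem x s = elem x s'"
  then have "x ` s = x ` s'" using extreme_points_elem[OF mesh] by metis
  moreover have "inj_on x {1..Nv}" using mesh by (simp add: simplicial_mesh_def)
  ultimately show "s = s'"
    using s vertices_subset[OF mesh] by (metis inj_on_image_eq_iff)
qed

lemma finite_edges_elem:
  assumes "simplicial_mesh \<Omega> Nv T x" "s \<in> T"
  shows "finite (edges (elem x s))"
  unfolding edges_def by (rule finite_polytope_facets[OF polytope_elem[OF assms]])

lemma measure_elem_pos:
  fixes x :: "nat \<Rightarrow> real^'d"
  assumes "simplicial_mesh \<Omega> Nv T x" "s \<in> T"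
  shows "measure lebesgue (elem x s) > 0"
proof -
  let ?K = "elem x s"
  have K: "polytope ?K" "aff_dim ?K = int CARD('d)"
    using polytope_elem aff_dim_elem assms by blast+
  have "interior ?K \<noteq> {}"
  proof
    assume "interior ?K = {}"
    moreover have "rel_interior ?K = interior ?K"
      using K by (intro rel_interior_interior) (simp flip: aff_dim_eq_full)
    ultimately show False
      using K polytope_imp_convex rel_interior_eq_empty by force
  qed
  then have "\<not> negligible ?K"
    using K polytope_imp_convex negligible_convex_interior by blast
  moreover have "?K \<in> lmeasurable"
    using K polytope_imp_compact lmeasurable_compact by blast
  ultimately show ?thesis
    by (metis measure_nonneg negligible_iff_measure order_le_less)
qed

text \<open>
  The intersection of two distinct elements is a proper face of each, so it cannot be larger
  than a common edge.
\<close>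

lemma elem_Int_eq_edge:
  assumes mesh: "simplicial_mesh \<Omega> Nv T x" and s: "s \<in> T" "s' \<in> T" "s \<noteq> s'"
    and e: "e \<in> edges (elem x s)" "e \<in> edges (elem x s')"
  shows "elem x s \<inter> elem x s' = e"
proof (rule ccontr)
  let ?K = "elem x s" and ?K' = "elem x s'"
  let ?F = "?K \<inter> ?K'"
  assume neq: "?F \<noteq> e"
  have tri: "triangulation (elem x ` T)" using mesh by (simp add: simplicial_mesh_def)
  have F: "?F face_of ?K" "?F face_of ?K'"
    using tri s unfolding triangulation_def by (metis Int_commute imageI)+
  have cK: "convex ?K" "convex ?K'"
    using polytope_elem[OF mesh] s polytope_imp_convex by blast+
  have e_face: "e face_of ?K" "e \<subseteq> ?F" and e_dim: "aff_dim e = aff_dim ?K - 1"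
    using e by (auto simp: edges_def facet_of_def dest: face_of_imp_subset)
  have "e face_of ?F"
    using face_of_subset[OF e_face] by blast
  then have "aff_dim e < aff_dim ?F"
    using neq cK convex_Int face_of_aff_dim_lt by blast
  then have ge: "aff_dim ?F \<ge> aff_dim ?K" "aff_dim ?F \<ge> aff_dim ?K'"
    using e_dim aff_dim_elem[OF mesh] s by auto
  have "?F = ?K" "?F = ?K'"
    using face_of_aff_dim_lt[OF cK(1) F(1)] face_of_aff_dim_lt[OF cK(2) F(2)] ge by fastforce+
  then have "?K = ?K'" by simp
  then show False using inj_on_elem[OF mesh] s by (auto dest: inj_onD)
qed

section \<open>Crossing an edge\<close>

lemma uminus_periods: "v \<in> periods L \<Longrightarrow> - v \<in> periods L"
  unfolding periods_def by (auto, metis mult_minus_left of_int_minus)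

lemma across_sym:
  assumes "p \<in> sides T x" "across L T x p p'"
  shows "across L T x p' p"
proof -
  obtain v where v: "v \<in> periods L" "snd p' = (+) v ` snd p" "p' \<noteq> p"
    using assms by (auto simp: across_def)
  have "snd p = (+) (- v) ` snd p'"
    by (simp add: v image_image)
  then show ?thesis
    using v uminus_periods assms(1) unfolding across_def by metis
qed

lemma
  fixes c :: "real^'d"
  assumes K: "polytope K" "aff_dim K = int CARD('d)" and e: "e facet_of K"
    and sub: "K \<subseteq> cube c L"
  shows outward_normal_lower_face: "\<forall>y\<in>e. y $ i = c $ i \<Longrightarrow> outward_normal K e = - axis i 1"
    and outward_normal_upper_face: "\<forall>y\<in>e. y $ i = c $ i + L \<Longrightarrow> outward_normal K e = axis i 1"
proof -
  have box: "c $ i \<le> z $ i" "z $ i \<le> c $ i + L" if "z \<in> K" for z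
    using that sub by (auto simp: cube_def mem_box_cart)
  show "outward_normal K e = - axis i 1" if "\<forall>y\<in>e. y $ i = c $ i"
    by (rule outward_normal_eqI[OF K e])
       (use that box in \<open>simp add: is_outward_normal_def inner_axis'\<close>)
  show "outward_normal K e = axis i 1" if "\<forall>y\<in>e. y $ i = c $ i + L"
    by (rule outward_normal_eqI[OF K e])
       (use that box in \<open>simp add: is_outward_normal_def inner_axis'\<close>)
qed

text \<open>
  The cube is only as wide as the smallest positive coordinate of a period, so a set and its
  translate fit into it only if they lie in the two opposite faces.
\<close>

lemma translated_edge_opposite_faces:
  fixes c v :: "real^'d"
  assumes L: "L > 0" and v: "v \<in> periods L" "v $ i > 0"
    and e: "e \<subseteq> cube c L" "(+) v ` e \<subseteq> cube c L"
  shows "\<forall>y\<in>e. y $ i = c $ i" "\<forall>y\<in>(+) v ` e. y $ i = c $ i + L"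
proof -
  obtain k :: int where k: "v $ i = of_int k * L" using v by (auto simp: periods_def)
  then have "k \<ge> 1" using v L by (simp add: zero_less_mult_iff)
  then have vL: "v $ i \<ge> L" using k L by simp
  have "c $ i \<le> y $ i" "v $ i + y $ i \<le> c $ i + L" if "y \<in> e" for y
    using that e by (auto simp: cube_def mem_box_cart subset_eq)
  then have *: "y $ i = c $ i" "(v + y) $ i = c $ i + L" if "y \<in> e" for y
    using that vL by fastforce+
  show "\<forall>y\<in>e. y $ i = c $ i" using * by blast
  show "\<forall>y\<in>(+) v ` e. y $ i = c $ i + L" using *(2) by blast
qed

text \<open>
  Either the two elements share the edge, and then lie on opposite sides of it, or the edge and
  its translate lie on opposite faces of the cube, whose outward normals are opposite.
\<close>

lemma outward_normal_across:
  fixes c :: "real^'d"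
  assumes L: "L > 0" and mesh: "simplicial_mesh (cube c L) Nv T x"
    and s: "s \<in> T" "e \<in> edges (elem x s)" and s': "s' \<in> T" "(+) v ` e \<in> edges (elem x s')"
    and v: "v \<in> periods L" and neq: "(s', (+) v ` e) \<noteq> (s, e)"
  shows "outward_normal (elem x s') ((+) v ` e) = - outward_normal (elem x s) e"
proof -
  note K = polytope_elem[OF mesh s(1)] aff_dim_elem[OF mesh s(1)]
  note K' = polytope_elem[OF mesh s'(1)] aff_dim_elem[OF mesh s'(1)]
  have e: "e facet_of elem x s" and e': "(+) v ` e facet_of elem x s'"
    using s s' by (auto simp: edges_def)
  have sub: "e \<subseteq> cube c L" "(+) v ` e \<subseteq> cube c L"
    using facet_of_imp_subset[OF e] facet_of_imp_subset[OF e']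
      elem_subset[OF mesh s(1)] elem_subset[OF mesh s'(1)] by blast+
  note lower = outward_normal_lower_face[OF K e elem_subset[OF mesh s(1)]]
    outward_normal_lower_face[OF K' e' elem_subset[OF mesh s'(1)]]
  note upper = outward_normal_upper_face[OF K e elem_subset[OF mesh s(1)]]
    outward_normal_upper_face[OF K' e' elem_subset[OF mesh s'(1)]]
  show ?thesis
  proof (cases "v = 0")
    case True
    then have v0: "(+) v ` e = e" by simp
    then have "s \<noteq> s'" using neq by auto
    have "elem x s \<inter> elem x s' = e"
      using elem_Int_eq_edge[OF mesh s(1) s'(1) \<open>s \<noteq> s'\<close> s(2)] s'(2) v0 by simp
    then show ?thesis
      using outward_normal_common_facet[OF K K' e] e' v0 by simp
  next
    case False
    then obtain i where i: "v $ i \<noteq> 0" by (auto simp: vec_eq_iff)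
    show ?thesis
    proof (cases "v $ i > 0")
      case True
      from translated_edge_opposite_faces[OF L v True sub] show ?thesis
        using lower upper by simp
    next
      case False
      have back_e: "(+) (- v) ` (+) v ` e = e" by (simp add: image_image)
      have "(- v) $ i > 0" using False i by simp
      from translated_edge_opposite_faces[OF L uminus_periods[OF v] this sub(2)] sub(1)
      show ?thesis
        using lower upper unfolding back_e by simp
    qed
  qed
qed

section \<open>Periodicity of the velocities\<close>

lemma translate_axis_multiple:
  fixes f :: "real^'d \<Rightarrow> 'b"
  assumes "\<And>y. f (y + axis i L) = f y"
  shows "f (y + axis i (of_int k * L)) = f y"
proof (induction k arbitrary: y rule: int_induct[where k = 0])
  case base
  have "axis i 0 = (0 :: real^'d)" by (simp add: vec_eq_iff axis_def)
  then show ?case by (simp only: of_int_0 mult_zero_left add_0_right)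
next
  case (step1 k)
  have "axis i (of_int (k + 1) * L) = axis i (of_int k * L) + axis i L"
    by (simp add: vec_eq_iff axis_def algebra_simps)
  then show ?case using step1 assms by (metis add.assoc)
next
  case (step2 k)
  have "axis i (of_int k * L) = axis i L + axis i (of_int (k - 1) * L)"
    by (simp add: vec_eq_iff axis_def algebra_simps)
  then have "f (y + axis i (of_int (k - 1) * L) + axis i L) = f (y + axis i (of_int k * L))"
    by (simp add: add_ac)
  then show ?case using step2 assms by metis
qed

text \<open>A period is a sum of multiples of \<open>L\<close> in the coordinate directions.\<close>

lemma translate_period:
  fixes f :: "real^'d \<Rightarrow> 'b"
  assumes f: "\<And>i y. f (y + axis i L) = f y" and v: "v \<in> periods L"
  shows "f (v + y) = f y"
proof -
  obtain k :: "'d \<Rightarrow> int" where k: "\<And>i. v $ i = of_int (k i) * L"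
    using v unfolding periods_def by (auto simp: choice_iff)
  have "f ((\<Sum>i\<in>I. axis i (v $ i)) + y) = f y" if "finite I" for I :: "'d set"
    using that
  proof (induction I arbitrary: y)
    case (insert i I)
    have "f ((\<Sum>i\<in>insert i I. axis i (v $ i)) + y) =
          f ((\<Sum>i\<in>I. axis i (v $ i)) + (y + axis i (of_int (k i) * L)))"
      using insert by (simp add: k add_ac)
    also have "\<dots> = f y"
      using insert.IH translate_axis_multiple[where f = f, OF f] by simp
    finally show ?case .
  qed simp
  moreover have "(\<Sum>i\<in>UNIV. axis i (v $ i)) = v"
    by (simp add: vec_eq_iff axis_def sum_component cong: if_cong)
  ultimately show ?thesis by (metis finite)
qed

text \<open>
  A period carries the vertices of an edge to vertices, where the nodal velocities agree.  On
  each of the two elements the mesh velocity is affine, and affine maps that agree on the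
  vertices of the edge agree on the edge.
\<close>

lemma mesh_velocity_across:
  fixes x :: "nat \<Rightarrow> real^'d"
  assumes mesh: "simplicial_mesh \<Omega> Nv T x"
    and per: "periodic_velocity L Nv x x' dt" and vel: "mesh_velocity Nv T x x' dt X"
    and s: "s \<in> T" "e \<in> edges (elem x s)" and s': "s' \<in> T" "(+) v ` e \<in> edges (elem x s')"
    and v: "v \<in> periods L" and y: "y \<in> e"
  shows "X (v + y) = X y"
proof -
  have e: "e face_of elem x s" and e': "(+) v ` e face_of elem x s'"
    using s s' by (auto simp: edges_def facet_of_def)
  have eK: "e \<subseteq> elem x s" and eK': "(+) v ` e \<subseteq> elem x s'"
    using e e' face_of_imp_subset by blast+
  have "compact e"
    using face_of_imp_compact[OF _ _ e] polytope_elem[OF mesh s(1)]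
      polytope_imp_convex polytope_imp_compact by blast
  then have hull: "e = convex hull {p. p extreme_point_of e}"
    using Krein_Milman_Minkowski e face_of_imp_convex by blast
  obtain f b where f: "linear f" "\<And>z. z \<in> elem x s \<Longrightarrow> X z = f z + b"
    using vel s by (auto simp: mesh_velocity_def)
  obtain f' b' where f': "linear f'" "\<And>z. z \<in> elem x s' \<Longrightarrow> X z = f' z + b'"
    using vel s' by (auto simp: mesh_velocity_def)
  have vertex: "X (v + p) = X p" if p: "p extreme_point_of e" for p
  proof -
    have "p extreme_point_of elem x s"
      using extreme_point_of_face[OF e] p by blast
    then obtain i where i: "i \<in> s" "p = x i"
      using extreme_points_elem[OF mesh s(1)] by blast
    have "v + p extreme_point_of (+) v ` e"
      using p by (simp add: extreme_point_of_translation_eq)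
    then have "v + p extreme_point_of elem x s'"
      using extreme_point_of_face[OF e'] by blast
    then obtain j where j: "j \<in> s'" "v + p = x j"
      using extreme_points_elem[OF mesh s'(1)] by blast
    have ij: "i \<in> {1..Nv}" "j \<in> {1..Nv}"
      using i j vertices_subset[OF mesh] s s' by blast+
    have "x j - x i = v" using i j by (metis add_diff_cancel_right')
    then have "nodal_velocity x x' dt j = nodal_velocity x x' dt i"
      using per v ij unfolding periodic_velocity_def by metis
    then show ?thesis
      using vel ij i j by (auto simp: mesh_velocity_def)
  qed
  define g where "g z = f' z - f z" for z
  have g: "linear g" unfolding g_def using f f' by (intro linear_compose_sub)
  let ?A = "{z. g z = b - f' v - b'}"
  have iff: "z \<in> ?A \<longleftrightarrow> X (v + z) = X z" if "z \<in> e" for z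
    using that eK eK' f(2)[of z] f'(2)[of "v + z"] linear_add[OF f'(1)]
    by (auto simp: g_def algebra_simps subset_eq)
  have "convex ?A"
    unfolding convex_def
    by (auto simp: linear_add[OF g] linear_scale[OF g] simp flip: scaleR_left.add)
  moreover have "{p. p extreme_point_of e} \<subseteq> ?A"
    using vertex iff by (auto simp: extreme_point_of_def)
  ultimately have "e \<subseteq> ?A" using hull hull_minimal by metis
  then show ?thesis using iff y by blast
qed

section \<open>The flux seen from the two sides of an edge\<close>

text \<open>
  The first component is \<^const>\<open>neighbour\<close>; keeping the edge next to it makes the map an
  involution on the sides.
\<close>

definition opposite ::
  "real \<Rightarrow> nat set set \<Rightarrow> (nat \<Rightarrow> real^'d) \<Rightarrow>
     nat set \<times> (real^'d) set \<Rightarrow> nat set \<times> (real^'d) set" where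
  "opposite L T x p = (THE p'. across L T x p p')"

lemma across_opposite:
  assumes "periodic_mesh c L Nv T x" "p \<in> sides T x"
  shows "across L T x p (opposite L T x p)"
  using assms unfolding opposite_def periodic_mesh_def by (blast intro: theI')

lemma opposite_in_sides:
  assumes "periodic_mesh c L Nv T x" "p \<in> sides T x"
  shows "opposite L T x p \<in> sides T x"
  using across_opposite[OF assms] by (simp add: across_def)

lemma opposite_opposite:
  assumes mesh: "periodic_mesh c L Nv T x" and p: "p \<in> sides T x"
  shows "opposite L T x (opposite L T x p) = p"
proof -
  let ?q = "opposite L T x p"
  have q: "?q \<in> sides T x" by (rule opposite_in_sides[OF mesh p])
  have "across L T x ?q p" by (rule across_sym[OF p across_opposite[OF mesh p]])
  then show ?thesis
    using mesh q across_opposite[OF mesh q] unfolding periodic_mesh_def by metis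
qed

lemma opposite_cases:
  assumes "periodic_mesh c L Nv T x" "s \<in> T" "e \<in> edges (elem x s)"
  obtains s' v where "opposite L T x (s, e) = (s', (+) v ` e)" "v \<in> periods L"
    "s' \<in> T" "(+) v ` e \<in> edges (elem x s')" "(s', (+) v ` e) \<noteq> (s, e)"
proof -
  have "(s, e) \<in> sides T x" using assms by (simp add: sides_def)
  then have "across L T x (s, e) (opposite L T x (s, e))"
    by (rule across_opposite[OF assms(1)])
  then show ?thesis
    using that by (cases "opposite L T x (s, e)") (auto simp: across_def sides_def)
qed

lemma lam_across:
  fixes c :: "real^'d"
  assumes L: "L > 0" and mesh: "simplicial_mesh (cube c L) Nv T x"
    and per: "periodic_velocity L Nv x x' dt" and vel: "mesh_velocity Nv T x x' dt X"
    and a: "\<And>i y t. a (y + axis i L) t = a y t"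
    and s: "s \<in> T" "e \<in> edges (elem x s)" and s': "s' \<in> T" "(+) v ` e \<in> edges (elem x s')"
    and v: "v \<in> periods L" and neq: "(s', (+) v ` e) \<noteq> (s, e)" and y: "y \<in> e"
  shows "lam a X t (elem x s') ((+) v ` e) (v + y) = - lam a X t (elem x s) e y"
proof -
  have "a (v + y) t = a y t"
    by (rule translate_period[where f = "\<lambda>y. a y t", OF a v])
  then show ?thesis
    by (simp add: lam_def mesh_velocity_across[OF mesh per vel s s' v y]
        outward_normal_across[OF L mesh s s' v neq])
qed

lemma alpha_LF_across:
  assumes alpha: "\<And>y. y \<in> Q e \<Longrightarrow> alpha a X t (elem x s') ((+) v ` e) (v + y) = alpha a X t (elem x s) e y"
    and Q: "Q ((+) v ` e) = (+) v ` Q e" and y: "y \<in> Q e"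
  shows "alpha_LF ch a X t Q T x s' ((+) v ` e) (v + y) = alpha_LF ch a X t Q T x s e y"
proof (cases ch)
  case Edge_Maximum
  then show ?thesis using alpha by (simp add: Q image_image cong: image_cong)
qed (use alpha y in simp_all)

text \<open>
  All three choices dominate the normal speed, so that the flux is a difference of
  outgoing and incoming transport with nonnegative coefficients.
\<close>

lemma abs_lam_le_alpha_LF:
  assumes mesh: "simplicial_mesh \<Omega> Nv T x"
    and quad: "edge_quadrature L (\<Union>s\<in>T. edges (elem x s)) Q w"
    and s: "s \<in> T" "e \<in> edges (elem x s)" and y: "y \<in> Q e"
  shows "\<bar>lam a X t (elem x s) e y\<bar> \<le> alpha_LF ch a X t Q T x s e y"
proof -
  have fin: "finite (Q e)" if "s \<in> T" "e \<in> edges (elem x s)" for s e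
    using quad that by (auto simp: edge_quadrature_def)
  show ?thesis
  proof (cases ch)
    case Pointwise
    then show ?thesis by (simp add: alpha_def)
  next
    case Edge_Maximum
    then show ?thesis using fin[OF s] y by (auto simp: alpha_def intro: Max_ge)
  next
    case Global_Maximum
    let ?M = "{alpha a X t (elem x s') e' y' | s' e' y'.
                 s' \<in> T \<and> e' \<in> edges (elem x s') \<and> y' \<in> Q e'}"
    have "?M = (\<Union>s'\<in>T. \<Union>e'\<in>edges (elem x s'). alpha a X t (elem x s') e' ` Q e')"
      by auto
    then have "finite ?M"
      using finite_mesh[OF mesh] finite_edges_elem[OF mesh] fin by simp
    moreover have "alpha a X t (elem x s) e y \<in> ?M" using s y by blast
    ultimately have "alpha a X t (elem x s) e y \<le> Max ?M" by (rule Max_ge)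
    then show ?thesis using Global_Maximum by (simp add: alpha_def)
  qed
qed

section \<open>Stability\<close>

text \<open>
  The update is a combination of the values of the element and of its neighbours whose
  coefficients are nonnegative, so it can be estimated by the triangle inequality.  What enters
  an element across a side is what leaves its neighbour across the opposite side, so that the
  inflow and outflow terms cancel when summed over the mesh.
\<close>

lemma paired_transport_L1_stable:
  fixes m m' U U' :: "'s \<Rightarrow> real" and E :: "'s \<Rightarrow> 'e set" and A :: "'s \<times> 'e \<Rightarrow> real"
  assumes fin: "finite T" "\<And>s. s \<in> T \<Longrightarrow> finite (E s)"
    and opp: "\<And>p. p \<in> Sigma T E \<Longrightarrow> opp p \<in> Sigma T E" "\<And>p. p \<in> Sigma T E \<Longrightarrow> opp (opp p) = p"
    and A: "\<And>p. p \<in> Sigma T E \<Longrightarrow> A p \<ge> 0" and dt: "dt \<ge> 0"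
    and m': "\<And>s. s \<in> T \<Longrightarrow> m' s \<ge> 0"
    and cfl: "\<And>s. s \<in> T \<Longrightarrow> dt * (\<Sum>e\<in>E s. A (s, e)) \<le> m s"
    and upd: "\<And>s. s \<in> T \<Longrightarrow> m' s * U' s =
      m s * U s - dt * (\<Sum>e\<in>E s. A (s, e) * U s - A (opp (s, e)) * U (fst (opp (s, e))))"
  shows "(\<Sum>s\<in>T. m' s * \<bar>U' s\<bar>) \<le> (\<Sum>s\<in>T. m s * \<bar>U s\<bar>)"
proof -
  define out where "out s = (\<Sum>e\<in>E s. A (s, e))" for s
  define inflow where "inflow p = A (opp p) * \<bar>U (fst (opp p))\<bar>" for p
  have step: "m' s * \<bar>U' s\<bar> \<le> (m s - dt * out s) * \<bar>U s\<bar> + dt * (\<Sum>e\<in>E s. inflow (s, e))"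
    if s: "s \<in> T" for s
  proof -
    let ?I = "\<Sum>e\<in>E s. A (opp (s, e)) * U (fst (opp (s, e)))"
    have "m' s * \<bar>U' s\<bar> = \<bar>m' s * U' s\<bar>"
      using m'[OF s] by (simp add: abs_mult)
    also have "m' s * U' s = (m s - dt * out s) * U s + dt * ?I"
      unfolding upd[OF s] out_def sum_subtractf sum_distrib_right[symmetric]
      by (simp add: algebra_simps)
    also have "\<bar>\<dots>\<bar> \<le> \<bar>(m s - dt * out s) * U s\<bar> + \<bar>dt * ?I\<bar>"
      by (rule abs_triangle_ineq)
    also have "\<bar>(m s - dt * out s) * U s\<bar> = (m s - dt * out s) * \<bar>U s\<bar>"
      using cfl[OF s] by (simp add: abs_mult out_def)
    also have "\<bar>dt * ?I\<bar> \<le> dt * (\<Sum>e\<in>E s. inflow (s, e))"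
    proof -
      have "\<bar>?I\<bar> \<le> (\<Sum>e\<in>E s. \<bar>A (opp (s, e)) * U (fst (opp (s, e)))\<bar>)"
        by (rule sum_abs)
      also have "\<dots> = (\<Sum>e\<in>E s. inflow (s, e))"
        using A opp(1) s by (intro sum.cong refl) (simp add: inflow_def abs_mult)
      finally show ?thesis using dt by (simp add: abs_mult mult_left_mono)
    qed
    finally show ?thesis by simp
  qed
  have "(\<Sum>s\<in>T. \<Sum>e\<in>E s. inflow (s, e)) = (\<Sum>p\<in>Sigma T E. inflow p)"
    using fin by (subst sum.Sigma) auto
  also have "\<dots> = (\<Sum>p\<in>Sigma T E. A p * \<bar>U (fst p)\<bar>)"
    by (rule sum.reindex_bij_witness[of _ opp opp]) (use opp in \<open>auto simp: inflow_def\<close>)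
  also have "\<dots> = (\<Sum>s\<in>T. \<Sum>e\<in>E s. A (s, e) * \<bar>U s\<bar>)"
    using fin by (subst sum.Sigma) (auto intro: sum.cong)
  finally have balance: "(\<Sum>s\<in>T. \<Sum>e\<in>E s. inflow (s, e)) = (\<Sum>s\<in>T. out s * \<bar>U s\<bar>)"
    by (simp add: out_def sum_distrib_right)
  have "(\<Sum>s\<in>T. m' s * \<bar>U' s\<bar>)
      \<le> (\<Sum>s\<in>T. (m s - dt * out s) * \<bar>U s\<bar> + dt * (\<Sum>e\<in>E s. inflow (s, e)))"
    by (rule sum_mono) (rule step)
  also have "\<dots> = (\<Sum>s\<in>T. (m s - dt * out s) * \<bar>U s\<bar>) + dt * (\<Sum>s\<in>T. out s * \<bar>U s\<bar>)"
    by (simp add: sum.distrib balance flip: sum_distrib_left)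
  also have "\<dots> = (\<Sum>s\<in>T. m s * \<bar>U s\<bar>)"
    by (simp add: sum_distrib_left sum_subtractf algebra_simps flip: sum.distrib)
  finally show ?thesis .
qed

text \<open>
  If the denominator is zero, then the sum on each element is at most zero, so that the bound
  holds although the CFL condition is vacuous.
\<close>

lemma cfl_denominator_bound:
  assumes mesh: "simplicial_mesh \<Omega> Nv T x" and dt: "dt > 0"
    and CFL: "cfl_denominator T x Q w aCFL \<noteq> 0 \<Longrightarrow> dt \<le> 1 / cfl_denominator T x Q w aCFL"
    and s: "s \<in> T"
  shows "dt * (\<Sum>e\<in>edges (elem x s). edge_measure (elem x s) e * (\<Sum>y\<in>Q e. w e y * aCFL e y))
           \<le> measure lebesgue (elem x s)"
    (is "dt * ?C \<le> ?m")
proof -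
  let ?D = "cfl_denominator T x Q w aCFL"
  have m: "?m > 0" by (rule measure_elem_pos[OF mesh s])
  have "1 / ?m * ?C \<le> ?D"
    unfolding cfl_denominator_def using finite_mesh[OF mesh] s by (intro Max_ge) auto
  then have C: "?C \<le> ?D * ?m" using m by (simp add: field_simps)
  have "dt * ?D \<le> 1"
  proof (cases "?D = 0")
    case False
    then have le: "dt \<le> 1 / ?D" by (rule CFL)
    then have "1 / ?D > 0" using dt by linarith
    then have "?D > 0" by simp
    then show ?thesis using le by (simp add: field_simps)
  qed simp
  have "dt * ?C \<le> dt * (?D * ?m)" using C dt by (intro mult_left_mono) auto
  also have "\<dots> = (dt * ?D) * ?m" by simp
  also have "\<dots> \<le> 1 * ?m" using \<open>dt * ?D \<le> 1\<close> m by (intro mult_right_mono) auto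
  finally show ?thesis by simp
qed

theorem proposition3p1:
  fixes c :: "real^'d" and L :: real
    and Nv :: nat and T :: "nat set set" and x x' :: "nat \<Rightarrow> real^'d"
    and tn dt :: real
    and a :: "real^'d \<Rightarrow> real \<Rightarrow> real^'d" and X :: "real^'d \<Rightarrow> real^'d"
    and Q :: "(real^'d) set \<Rightarrow> (real^'d) set"
    and w aCFL :: "(real^'d) set \<Rightarrow> real^'d \<Rightarrow> real"
    and ch :: lf_choice
    and U U' :: "nat set \<Rightarrow> real"
  assumes L_pos: "L > 0"
    and dt_pos: "dt > 0"
    and mesh_old: "periodic_mesh c L Nv T x"
    and mesh_new: "periodic_mesh c L Nv T x'"
    and velocity_periodic: "periodic_velocity L Nv x x' dt"
    and velocity: "mesh_velocity Nv T x x' dt X"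
    and quadrature: "edge_quadrature L (\<Union>s\<in>T. edges (elem x s)) Q w"
    and a_periodic: "\<And>i y t. a (y + axis i L) t = a y t"
    and scheme: "\<And>s. s \<in> T \<Longrightarrow>
          measure lebesgue (elem x' s) * U' s =
          measure lebesgue (elem x s) * U s
          - dt * (\<Sum>e\<in>edges (elem x s). edge_measure (elem x s) e *
                    (\<Sum>y\<in>Q e. w e y * LF_flux ch a X tn Q L T x U s e y))"
    and aCFL_ge: "\<And>s e y. s \<in> T \<Longrightarrow> e \<in> edges (elem x s) \<Longrightarrow> y \<in> Q e \<Longrightarrow>
          aCFL e y \<ge> alpha_LF ch a X tn Q T x s e y"
    and CFL: "cfl_denominator T x Q w aCFL \<noteq> 0 \<Longrightarrow>
          dt \<le> 1 / cfl_denominator T x Q w aCFL"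
  shows "(\<Sum>s\<in>T. measure lebesgue (elem x' s) * \<bar>U' s\<bar>)
       \<le> (\<Sum>s\<in>T. measure lebesgue (elem x s) * \<bar>U s\<bar>)"
proof -
  have mesh: "simplicial_mesh (cube c L) Nv T x"
    using mesh_old by (simp add: periodic_mesh_def)
  note quad = quadrature[unfolded edge_quadrature_def]
  define \<mu> where "\<mu> s e y = lam a X tn (elem x s) e y" for s e y
  define \<alpha> where "\<alpha> s e y = alpha_LF ch a X tn Q T x s e y" for s e y
  define A where "A p = (case p of (s, e) \<Rightarrow> edge_measure (elem x s) e *
      (\<Sum>y\<in>Q e. w e y * ((\<alpha> s e y + \<mu> s e y) / 2)))" for p
  let ?E = "\<lambda>s. edges (elem x s)" and ?opp = "opposite L T x"
  have sides: "sides T x = Sigma T ?E" by (auto simp: sides_def)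
  have w: "w e y \<ge> 0" if "s \<in> T" "e \<in> ?E s" "y \<in> Q e" for s e y
    using quad that by blast
  have em: "edge_measure K e \<ge> 0" for K e :: "(real^'d) set"
    by (simp add: edge_measure_def)
  have \<alpha>: "\<bar>\<mu> s e y\<bar> \<le> \<alpha> s e y" if "s \<in> T" "e \<in> ?E s" "y \<in> Q e" for s e y
    unfolding \<alpha>_def \<mu>_def by (rule abs_lam_le_alpha_LF[OF mesh quadrature that])
  have A_nonneg: "A p \<ge> 0" if side: "p \<in> Sigma T ?E" for p
  proof -
    obtain s e where p: "p = (s, e)" "s \<in> T" "e \<in> ?E s" using side by auto
    have "(\<alpha> s e y + \<mu> s e y) / 2 \<ge> 0" if "y \<in> Q e" for y
      using abs_le_D2[OF \<alpha>[OF p(2,3) that]] by simp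
    then show ?thesis
      using em w[OF p(2,3)] unfolding p(1) A_def prod.case
      by (intro mult_nonneg_nonneg sum_nonneg) auto
  qed
  \<comment> \<open>Seen from the other side, \<open>\<mu>\<close> changes sign and everything else stays the same.\<close>
  have A_opp: "A (?opp (s, e)) =
      edge_measure (elem x s) e * (\<Sum>y\<in>Q e. w e y * ((\<alpha> s e y - \<mu> s e y) / 2))"
    if s: "s \<in> T" "e \<in> ?E s" for s e
  proof -
    obtain s' v where opp: "?opp (s, e) = (s', (+) v ` e)" and v: "v \<in> periods L"
      and s': "s' \<in> T" "(+) v ` e \<in> ?E s'" and neq: "(s', (+) v ` e) \<noteq> (s, e)"
      using opposite_cases[OF mesh_old s] .
    have Q: "Q ((+) v ` e) = (+) v ` Q e" and wv: "\<And>y. y \<in> Q e \<Longrightarrow> w ((+) v ` e) (v + y) = w e y"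
      and Qe: "Q e \<subseteq> e"
      using quad s s' v by blast+
    have \<mu>v: "\<mu> s' ((+) v ` e) (v + y) = - \<mu> s e y" if "y \<in> Q e" for y
      unfolding \<mu>_def using that Qe
      by (intro lam_across[OF L_pos mesh velocity_periodic velocity a_periodic s s' v neq]) auto
    have \<alpha>v: "\<alpha> s' ((+) v ` e) (v + y) = \<alpha> s e y" if "y \<in> Q e" for y
      unfolding \<alpha>_def
    proof (rule alpha_LF_across[OF _ Q that])
      show "alpha a X tn (elem x s') ((+) v ` e) (v + z) = alpha a X tn (elem x s) e z"
        if "z \<in> Q e" for z
        using \<mu>v[OF that] by (simp add: alpha_def \<mu>_def)
    qed
    have "A (?opp (s, e)) = edge_measure (elem x s) e *
        (\<Sum>y\<in>(+) v ` Q e. w ((+) v ` e) y * ((\<alpha> s' ((+) v ` e) y + \<mu> s' ((+) v ` e) y) / 2))"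
      using edge_measure_translate[OF outward_normal_across[OF L_pos mesh s s' v neq]]
      by (simp add: opp A_def Q)
    also have "\<dots> = edge_measure (elem x s) e *
        (\<Sum>y\<in>Q e. w e y * ((\<alpha> s e y - \<mu> s e y) / 2))"
      by (subst sum.reindex) (simp_all add: wv \<mu>v \<alpha>v cong: sum.cong)
    finally show ?thesis .
  qed
  show ?thesis
  proof (rule paired_transport_L1_stable[where E = ?E and opp = ?opp and A = A and dt = dt])
    show "finite T" "\<And>s. s \<in> T \<Longrightarrow> finite (?E s)"
      using finite_mesh[OF mesh] finite_edges_elem[OF mesh] by auto
    show "?opp p \<in> Sigma T ?E" "?opp (?opp p) = p" if "p \<in> Sigma T ?E" for p
      using opposite_in_sides[OF mesh_old] opposite_opposite[OF mesh_old] that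
      by (simp_all only: sides)
    show "dt * (\<Sum>e\<in>?E s. A (s, e)) \<le> measure lebesgue (elem x s)" if s: "s \<in> T" for s
    proof -
      have "(\<alpha> s e y + \<mu> s e y) / 2 \<le> aCFL e y" if "e \<in> ?E s" "y \<in> Q e" for e y
        using aCFL_ge[OF s that] abs_le_D1[OF \<alpha>[OF s that]] unfolding \<alpha>_def[symmetric] by simp
      then have "(\<Sum>e\<in>?E s. A (s, e)) \<le>
          (\<Sum>e\<in>?E s. edge_measure (elem x s) e * (\<Sum>y\<in>Q e. w e y * aCFL e y))"
        unfolding A_def prod.case using em w[OF s]
        by (intro sum_mono mult_left_mono) auto
      then have "dt * (\<Sum>e\<in>?E s. A (s, e)) \<le>
          dt * (\<Sum>e\<in>?E s. edge_measure (elem x s) e * (\<Sum>y\<in>Q e. w e y * aCFL e y))"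
        using dt_pos by (intro mult_left_mono) auto
      also have "\<dots> \<le> measure lebesgue (elem x s)"
        by (rule cfl_denominator_bound[OF mesh dt_pos CFL s])
      finally show ?thesis .
    qed
    show "measure lebesgue (elem x' s) * U' s = measure lebesgue (elem x s) * U s -
        dt * (\<Sum>e\<in>?E s. A (s, e) * U s - A (?opp (s, e)) * U (fst (?opp (s, e))))"
      if s: "s \<in> T" for s
    proof -
      have "edge_measure (elem x s) e * (\<Sum>y\<in>Q e. w e y * LF_flux ch a X tn Q L T x U s e y) =
          A (s, e) * U s - A (?opp (s, e)) * U (fst (?opp (s, e)))" if e: "e \<in> ?E s" for e
      proof -
        let ?V = "U (fst (?opp (s, e)))"
        have "(\<Sum>y\<in>Q e. w e y * LF_flux ch a X tn Q L T x U s e y) =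
            (\<Sum>y\<in>Q e. w e y * ((\<alpha> s e y + \<mu> s e y) / 2) * U s
                     - w e y * ((\<alpha> s e y - \<mu> s e y) / 2) * ?V)"
          by (intro sum.cong refl)
             (simp add: LF_flux_def Let_def neighbour_def opposite_def \<alpha>_def \<mu>_def field_simps)
        also have "\<dots> = (\<Sum>y\<in>Q e. w e y * ((\<alpha> s e y + \<mu> s e y) / 2)) * U s
            - (\<Sum>y\<in>Q e. w e y * ((\<alpha> s e y - \<mu> s e y) / 2)) * ?V"
          by (simp only: sum_subtractf sum_distrib_right)
        finally show ?thesis
          unfolding A_opp[OF s e] by (simp add: A_def right_diff_distrib mult.assoc)
      qed
      then show ?thesis
        unfolding scheme[OF s] by simp
    qed
  qed (use dt_pos A_nonneg in auto)
qed

end
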